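(* Let $a$ and $b$ be any positive integers and $n$ a nonnegative integer. Then the number of zero-sum words of length $(a+b)n$ in the alphabet $\{+a,-b\}$ that contain no illegal subword whose length is a multiple of $a+b$ is $\binom{a+b}{a}^n$.
   Context: A word in the alphabet $\{+a,-b\}$ is a finite sequence $w=w_1\cdots w_m$ with each $w_i\in\{+a,-b\}$; it is zero-sum if $\sum_i w_i=0$. A consecutive subword $w_i\cdots w_j$ ($1\le i\le j\le m$), of length $j-i+1$, is illegal if it is zero-sum, $w_i=+a$, and $j<m$ with $w_{j+1}=-b$. *)

theory Defs
  imports Main
begin

definition words :: "nat \<Rightarrow> nat \<Rightarrow> nat \<Rightarrow> int list set" where
  "words a b m = {w. set w \<subseteq> {int a, - int b} \<and> length w = m}"

definition zero_sum :: "int list \<Rightarrow> bool" where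
  "zero_sum w \<longleftrightarrow> sum_list w = 0"

(* The consecutive letters of w at the 0-based positions i, ..., j (inclusive). *)
definition subword :: "int list \<Rightarrow> nat \<Rightarrow> nat \<Rightarrow> int list" where
  "subword w i j = take (Suc j - i) (drop i w)"

(* Positions are 0-based; illegality depends on the occurrence (i, j), since it
   refers to the letter of w that follows the subword. *)
definition illegal :: "nat \<Rightarrow> nat \<Rightarrow> int list \<Rightarrow> nat \<Rightarrow> nat \<Rightarrow> bool" where
  "illegal a b w i j \<longleftrightarrow>
     i \<le> j \<and> Suc j < length w \<and> zero_sum (subword w i j) \<and>
     w ! i = int a \<and> w ! Suc j = - int b"

end

theory Submission
  imports Defs
begin

text \<open>
  Put \<open>c = a + b\<close> and regard a zero-sum word of length \<open>c n\<close> as a closed walk whose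
  vertices are the pairs (height, time modulo \<open>c\<close>).  Having no illegal subword of length
  divisible by \<open>c\<close> means that at every vertex all down-steps are taken before all up-steps.
  A zero-sum word \<open>B\<close> of length \<open>c\<close> gives a \<open>c\<close>-periodic path; shift it
  vertically until it lies below a legal walk and touches it, and insert one turn around it at the
  first time of contact.  The result is again legal.  Conversely, heights in one residue class of
  times are congruent modulo \<open>c\<close>, and therefore the lower envelope of a legal walk is a
  closed path which the walk follows for one full turn as soon as it first reaches it; that turn
  can be removed.  Hence legal words of length \<open>c (n + 1)\<close> correspond to pairs of a legal
  word of length \<open>c n\<close> and one of the \<open>c choose a\<close> zero-sum words of length
  \<open>c\<close>.
\<close>

section \<open>Heights and periodic paths\<close>

definition height :: "int list \<Rightarrow> nat \<Rightarrow> int" where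
  "height w t = sum_list (take t w)"

text \<open>For a zero-sum \<open>w\<close> this is the height along the endless repetition of
  \<open>w\<close>; reducing the time modulo \<open>length w\<close> keeps all words finite.\<close>

definition periodic_height :: "int list \<Rightarrow> nat \<Rightarrow> int" where
  "periodic_height w t = height w (t mod length w)"

lemma height_0 [simp]: "height w 0 = 0"
  by (simp add: height_def)

lemma height_length: "height w (length w) = sum_list w"
  by (simp add: height_def)

lemma height_Suc: "t < length w \<Longrightarrow> height w (Suc t) = height w t + w ! t"
  by (simp add: height_def take_Suc_conv_app_nth)

lemma height_append1: "t \<le> length u \<Longrightarrow> height (u @ v) t = height u t"
  by (simp add: height_def)

lemma height_append2: "height (u @ v) (length u + t) = sum_list u + height v t"
  by (simp add: height_def)

lemma sum_list_subword:
  assumes "i \<le> j" "j < length w"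
  shows "sum_list (subword w i j) = height w (Suc j) - height w i"
proof -
  have "take (Suc j) w = take i w @ take (Suc j - i) (drop i w)"
    using assms by (metis le_SucI le_add_diff_inverse take_add)
  then show ?thesis by (simp add: height_def subword_def)
qed

lemma length_subword: "i \<le> j \<Longrightarrow> j < length w \<Longrightarrow> length (subword w i j) = Suc j - i"
  by (simp add: subword_def)

lemma periodic_height_cong:
  "s mod length w = t mod length w \<Longrightarrow> periodic_height w s = periodic_height w t"
  by (simp add: periodic_height_def)

lemma periodic_height_Suc:
  assumes "sum_list w = 0" "w \<noteq> []"
  shows "periodic_height w (Suc t) = periodic_height w t + w ! (t mod length w)"
proof -
  have lt: "t mod length w < length w" using assms by simp
  have "height w (Suc t mod length w) = height w (Suc (t mod length w))"
    using assms by (auto simp: mod_Suc height_length)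
  then show ?thesis
    using height_Suc[OF lt] by (simp add: periodic_height_def)
qed

text \<open>Rotation only changes the phase at which the periodic path is entered. Hence a copy of
  \<open>rotate s B\<close> spliced in at time \<open>s\<close> runs in phase with the path of
  \<open>B\<close>.\<close>

lemma height_rotate:
  assumes "sum_list w = 0" "w \<noteq> []" "s \<le> length w"
  shows "height (rotate t w) s = periodic_height w (t + s) - periodic_height w t"
  using assms(3)
proof (induction s)
  case 0
  then show ?case by simp
next
  case (Suc s)
  then have "height (rotate t w) (Suc s) = height (rotate t w) s + w ! ((t + s) mod length w)"
    by (simp add: height_Suc nth_rotate)
  then show ?case
    using Suc periodic_height_Suc[OF assms(1,2), of "t + s"] by simp
qed

lemma sum_list_rotate: "sum_list (rotate t w) = sum_list (w :: int list)"
  by (metis add.commute append_take_drop_id rotate_drop_take sum_list_append)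

section \<open>First contact of a word with a periodic path\<close>

text \<open>\<open>m\<close> is the vertical shift that pushes the path of \<open>B\<close> up
  against the walk \<open>w\<close> from below, and \<open>s\<close> is the earliest time at which
  they touch.\<close>

definition first_contact :: "int list \<Rightarrow> int list \<Rightarrow> int \<Rightarrow> nat \<Rightarrow> bool" where
  "first_contact w B m s \<longleftrightarrow>
     s \<le> length w \<and> height w s = m + periodic_height B s \<and>
     (\<forall>t\<le>length w. m + periodic_height B t \<le> height w t) \<and>
     (\<forall>t<s. m + periodic_height B t < height w t)"

lemma first_contact_exists: "\<exists>m s. first_contact w B m s"
proof -
  let ?f = "\<lambda>t. height w t - periodic_height B t"
  define m where "m = Min (?f ` {..length w})"
  have min: "m \<le> ?f t" if "t \<le> length w" for t
    using that by (auto simp: m_def intro!: Min_le)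
  have "m \<in> ?f ` {..length w}"
    unfolding m_def by (rule Min_in) auto
  then obtain t where t: "t \<le> length w" "?f t = m" by auto
  \<comment> \<open>\<open>LEAST\<close> ranges over all times, including those beyond
    \<open>length w\<close>; comparison with the minimiser \<open>t\<close> supplies the
    bound.\<close>
  define s where "s = (LEAST t. ?f t = m)"
  have s: "?f s = m" unfolding s_def by (rule LeastI[of _ t]) (rule t)
  have least: "?f r \<noteq> m" if "r < s" for r
    using that not_less_Least unfolding s_def by blast
  have "s \<le> t" unfolding s_def by (rule Least_le) (rule t)
  then have "s \<le> length w" using t by simp
  moreover have "m + periodic_height B r < height w r" if "r < s" for r
    using min[of r] least[OF that] that \<open>s \<le> length w\<close> by simp
  ultimately have "first_contact w B m s"
    using s min unfolding first_contact_def by (smt (verit))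
  then show ?thesis by blast
qed

text \<open>Each shift is a lower bound for the difference of the two heights and is attained, so
  both equal its minimum; the times are then the first minimiser.\<close>

lemma first_contact_unique:
  assumes "first_contact w B m s" "first_contact w B m' s'"
  shows "m = m'" "s = s'"
proof -
  show m: "m = m'"
    using assms unfolding first_contact_def by (smt (verit))
  show "s = s'"
    using assms m unfolding first_contact_def by (metis less_irrefl linorder_neqE_nat)
qed

definition contact_time :: "int list \<Rightarrow> int list \<Rightarrow> nat" where
  "contact_time w B = (THE s. \<exists>m. first_contact w B m s)"

lemma contact_time_eq: "first_contact w B m s \<Longrightarrow> contact_time w B = s"
  unfolding contact_time_def using first_contact_unique(2) by blast

definition insert_turn :: "int list \<Rightarrow> int list \<Rightarrow> int list" where
  "insert_turn w B =
     (let s = contact_time w B in take s w @ rotate s B @ drop s w)"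

lemma length_insert_turn: "length (insert_turn w B) = length w + length B"
  by (simp add: insert_turn_def Let_def)

text \<open>Three phases: before, during and after the turn. The turn is closed, so the remainder of
  \<open>w\<close> keeps its heights and is merely delayed by \<open>length B\<close>.\<close>

lemma height_insert_turn:
  assumes fc: "first_contact w B m s" and B: "sum_list B = 0" "B \<noteq> []"
  shows "t \<le> s \<Longrightarrow> height (insert_turn w B) t = height w t"
    and "s \<le> t \<Longrightarrow> t \<le> s + length B \<Longrightarrow>
           height (insert_turn w B) t = m + periodic_height B t"
    and "s + length B \<le> t \<Longrightarrow>
           height (insert_turn w B) t = height w (t - length B)"
proof -
  have v: "insert_turn w B = take s w @ rotate s B @ drop s w"
    using contact_time_eq[OF fc] by (simp add: insert_turn_def)
  have s: "s \<le> length w" "height w s = m + periodic_height B s"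
    using fc by (auto simp: first_contact_def)
  have len: "length (take s w) = s" using s by simp
  show "height (insert_turn w B) t = height w t" if "t \<le> s"
    using that s by (simp add: v height_append1 height_def min_def)
  show "height (insert_turn w B) t = m + periodic_height B t"
    if t: "s \<le> t" "t \<le> s + length B"
  proof -
    have "height (insert_turn w B) t
        = height w s + height (rotate s B @ drop s w) (t - s)"
      using height_append2[of "take s w" "rotate s B @ drop s w" "t - s"] len t
      by (simp add: v height_def)
    also have "\<dots> = m + periodic_height B t"
      using height_rotate[OF B, of "t - s" s] s(2) t by (simp add: height_append1)
    finally show ?thesis .
  qed
  show "height (insert_turn w B) t = height w (t - length B)"
    if t: "s + length B \<le> t"
  proof -
    define k where "k = t - (s + length B)"
    have t': "t = s + (length B + k)" using t by (simp add: k_def)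
    have "height (insert_turn w B) t = height w s + (0 + height (drop s w) k)"
      using height_append2[of "take s w" "rotate s B @ drop s w" "length B + k"] len
        height_append2[of "rotate s B" "drop s w" k] B
      by (simp add: v t' height_def sum_list_rotate)
    also have "\<dots> = height (take s w @ drop s w) (s + k)"
      using height_append2[of "take s w" "drop s w" k] len by (simp add: height_def)
    finally show ?thesis by (simp add: t')
  qed
qed

lemma nth_insert_turn:
  assumes fc: "first_contact w B m s"
  shows "t < s \<Longrightarrow> insert_turn w B ! t = w ! t"
    and "s \<le> t \<Longrightarrow> t < s + length B \<Longrightarrow> insert_turn w B ! t = B ! (t mod length B)"
    and "s + length B \<le> t \<Longrightarrow> t < length w + length B \<Longrightarrow>
           insert_turn w B ! t = w ! (t - length B)"
proof -
  have v: "insert_turn w B = take s w @ rotate s B @ drop s w"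
    using contact_time_eq[OF fc] by (simp add: insert_turn_def)
  have s: "s \<le> length w" using fc by (auto simp: first_contact_def)
  show "insert_turn w B ! t = w ! t" if "t < s"
    using that s by (simp add: v nth_append)
  show "insert_turn w B ! t = B ! (t mod length B)" if t: "s \<le> t" "t < s + length B"
  proof -
    have "t - s < length B" using t by linarith
    then show ?thesis using t s by (simp add: v nth_append nth_rotate)
  qed
  show "insert_turn w B ! t = w ! (t - length B)"
    if t: "s + length B \<le> t" "t < length w + length B"
  proof -
    have "\<not> t - s < length B" "\<not> t < s" using t by linarith+
    then show ?thesis using t s by (simp add: v nth_append)
  qed
qed

section \<open>Legal words\<close>

text \<open>Here \<open>k\<close> is the position just after the subword, that is
  \<open>Suc j\<close>. Equal heights say that the subword is zero-sum, equal residues that its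
  length is a multiple of \<open>a + b\<close>.\<close>

definition legal :: "nat \<Rightarrow> nat \<Rightarrow> int list \<Rightarrow> bool" where
  "legal a b w \<longleftrightarrow>
     (\<forall>i k. i < k \<longrightarrow> k < length w \<longrightarrow> i mod (a + b) = k mod (a + b) \<longrightarrow>
        height w i = height w k \<longrightarrow> w ! i = int a \<longrightarrow> w ! k \<noteq> - int b)"

lemma legal_iff:
  "legal a b w \<longleftrightarrow>
     \<not> (\<exists>i j. illegal a b w i j \<and> (a + b) dvd length (subword w i j))"
proof -
  have *: "illegal a b w i j \<and> (a + b) dvd length (subword w i j) \<longleftrightarrow>
      i < Suc j \<and> Suc j < length w \<and> i mod (a + b) = Suc j mod (a + b) \<and>
      height w i = height w (Suc j) \<and> w ! i = int a \<and> w ! Suc j = - int b" for i j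
  proof (cases "i \<le> j \<and> Suc j < length w")
    case True
    then have "(a + b) dvd (Suc j - i) \<longleftrightarrow> i mod (a + b) = Suc j mod (a + b)"
      by (metis le_SucI mod_eq_dvd_iff_nat)
    then show ?thesis
      using True by (auto simp: illegal_def zero_sum_def sum_list_subword length_subword)
  next
    case False
    then show ?thesis by (auto simp: illegal_def)
  qed
  show ?thesis
    unfolding * legal_def
    by (metis less_imp_Suc_add)
qed

definition zero_words :: "nat \<Rightarrow> nat \<Rightarrow> nat \<Rightarrow> int list set" where
  "zero_words a b m = {w \<in> words a b m. zero_sum w}"

definition legal_words :: "nat \<Rightarrow> nat \<Rightarrow> nat \<Rightarrow> int list set" where
  "legal_words a b m = {w \<in> zero_words a b m. legal a b w}"

lemma zero_wordsD:
  assumes "w \<in> zero_words a b m"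
  shows "set w \<subseteq> {int a, - int b}" "length w = m" "sum_list w = 0"
  using assms by (auto simp: zero_words_def words_def zero_sum_def)

text \<open>A supposed violation is located relative to the inserted turn. If both positions lie
  outside the turn, it was already a violation in \<open>w\<close>; if one lies inside, it
  contradicts that the path of \<open>B\<close> runs below \<open>w\<close>.\<close>

lemma legal_insert_turn:
  assumes pos: "a > 0" "b > 0"
    and w: "w \<in> legal_words a b ((a + b) * n)" and B: "B \<in> zero_words a b (a + b)"
  shows "insert_turn w B \<in> legal_words a b ((a + b) * Suc n)"
proof -
  let ?v = "insert_turn w B"
  obtain m s where fc: "first_contact w B m s" using first_contact_exists by blast
  have lw: "legal a b w" and lenw: "length w = (a + b) * n" and setw: "set w \<subseteq> {int a, - int b}"
    and sumw: "sum_list w = 0"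
    using w zero_wordsD[of w a b] by (auto simp: legal_words_def)
  note BB = zero_wordsD[OF B]
  have Bne: "B \<noteq> []" using BB(2) pos by auto
  have below: "m + periodic_height B t \<le> height w t" if "t \<le> length w" for t
    using fc that by (auto simp: first_contact_def)
  have before: "m + periodic_height B t < height w t" if "t < s" for t
    using fc that by (auto simp: first_contact_def)
  have s: "s \<le> length w" using fc by (auto simp: first_contact_def)
  note h = height_insert_turn[OF fc BB(3) Bne, unfolded BB(2)]
  note nth = nth_insert_turn[OF fc, unfolded BB(2)]
  have lenv: "length ?v = length w + (a + b)" using BB(2) by (simp add: length_insert_turn)
  have "set ?v \<subseteq> {int a, - int b}"
    using setw BB(1) by (auto simp: insert_turn_def Let_def dest: in_set_takeD in_set_dropD)
  moreover have "sum_list ?v = 0"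
    using h(3)[of "length ?v"] s sumw lenv by (simp add: height_length[symmetric])
  moreover have "legal a b ?v"
    unfolding legal_def
  proof (intro allI impI notI)
    fix i k
    assume ik: "i < k" "k < length ?v" "i mod (a + b) = k mod (a + b)"
      "height ?v i = height ?v k" "?v ! i = int a" "?v ! k = - int b"
    have dvd: "(a + b) dvd (k - i)"
      using ik(1,3) by (metis less_imp_le_nat mod_eq_dvd_iff_nat)
    then have far: "i + (a + b) \<le> k" using ik(1) dvd_imp_le[of "a + b" "k - i"] by simp
    have per: "periodic_height B i = periodic_height B k"
      using ik(3) BB(2) by (intro periodic_height_cong) simp
    have old: False if "i' < k'" "k' < length w" "i' mod (a + b) = k' mod (a + b)"
      "height w i' = height w k'" "w ! i' = int a" "w ! k' = - int b" for i' k'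
      using lw that unfolding legal_def by blast
    \<comment> \<open>The positions are at least a full period apart, so they cannot both lie in the
      turn.\<close>
    consider "k < s" | "i < s" "s \<le> k" "k < s + (a + b)" | "i < s" "s + (a + b) \<le> k"
      | "s \<le> i" "i < s + (a + b)" "s + (a + b) \<le> k" | "s + (a + b) \<le> i"
      using far by linarith
    then show False
    proof cases
      case 1
      then show ?thesis using old[of i k] ik s h(1)[of i] h(1)[of k] nth(1)[of i] nth(1)[of k] by simp
    next
      case 2
      \<comment> \<open>Before the contact the walk is strictly above the path, whereas the turn
        lies on it; at congruent times the path has a single height.\<close>
      then show ?thesis using before[of i] per ik(4) h(1)[of i] h(2)[of k] by simp
    next
      case 3
      have "i mod (a + b) = (k - (a + b)) mod (a + b)"
        using ik(3) far by (metis add_leD2 le_mod_geq)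
      moreover have "i < k - (a + b)" "k - (a + b) < length w"
        using 3 ik(2) lenv by linarith+
      ultimately show ?thesis
        using 3 old[of i "k - (a + b)"] ik s lenv h(1)[of i] h(3)[of k] nth(1)[of i] nth(3)[of k]
        by simp
    next
      case 4
      \<comment> \<open>the inserted turn goes up here, so a later down-step would go below it\<close>
      have "B ! (i mod (a + b)) = int a" using nth(2)[of i] 4 ik(5) by simp
      then have "periodic_height B (Suc k) = periodic_height B k + int a"
        using periodic_height_Suc[OF BB(3) Bne, of k] BB(2) ik(3) by simp
      moreover have "height ?v (Suc k) = height ?v k - int b"
        using height_Suc[OF ik(2)] ik(6) by simp
      moreover have "height ?v k = m + periodic_height B k"
        using ik(4) h(2)[of i] per 4 by simp
      moreover have "m + periodic_height B (Suc k) \<le> height ?v (Suc k)"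
      proof -
        have "periodic_height B (Suc k) = periodic_height B (Suc k - (a + b))"
          using 4 BB(2) by (intro periodic_height_cong) (metis add_leD2 le_SucI le_mod_geq)
        then show ?thesis
          using below[of "Suc k - (a + b)"] h(3)[of "Suc k"] 4 ik(2) lenv by simp
      qed
      ultimately show ?thesis using pos by simp
    next
      case 5
      have "(i - (a + b)) mod (a + b) = (k - (a + b)) mod (a + b)"
        using ik(3) 5 far by (metis add_leD2 le_mod_geq)
      moreover have "i - (a + b) < k - (a + b)" "k - (a + b) < length w"
        using 5 ik(1,2) lenv by linarith+
      ultimately show ?thesis
        using 5 old[of "i - (a + b)" "k - (a + b)"] ik lenv h(3)[of i] h(3)[of k]
          nth(3)[of i] nth(3)[of k] by simp
    qed
  qed
  ultimately show ?thesis
    using lenv lenw by (simp add: legal_words_def zero_words_def words_def zero_sum_def algebra_simps)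
qed

text \<open>The remainder is delayed by a whole period, which the path does not notice, so the path
  stays a lower bound. As the turn runs along it, it is the lower envelope of the result and can be
  read off from it.\<close>

lemma insert_turn_above:
  assumes fc: "first_contact w B m s" and B: "sum_list B = 0" "B \<noteq> []"
    and t: "t \<le> length (insert_turn w B)"
  shows "m + periodic_height B t \<le> height (insert_turn w B) t"
proof -
  have below: "m + periodic_height B t \<le> height w t" if "t \<le> length w" for t
    using fc that by (auto simp: first_contact_def)
  have s: "s \<le> length w" using fc by (auto simp: first_contact_def)
  note h = height_insert_turn[OF fc B]
  consider "t \<le> s" | "s \<le> t" "t \<le> s + length B" | "s + length B \<le> t" by linarith
  then show ?thesis
  proof cases
    case 1
    then show ?thesis using below[of t] h(1)[of t] s by simp
  next
    case 2
    then show ?thesis using h(2)[of t] by simp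
  next
    case 3
    have "periodic_height B t = periodic_height B (t - length B)"
      using 3 by (intro periodic_height_cong) (metis add_leD2 le_mod_geq)
    then show ?thesis
      using 3 below[of "t - length B"] h(3)[of t] t by (simp add: length_insert_turn)
  qed
qed

lemma exists_congruent_between:
  fixes s t c :: nat
  assumes "c > 0"
  shows "\<exists>r. s \<le> r \<and> r < s + c \<and> r mod c = t mod c"
proof -
  \<comment> \<open>Adding \<open>c * s\<close> leaves the residue of \<open>t\<close> unchanged and
    prevents the natural subtraction of \<open>s\<close> from truncating.\<close>
  define r where "r = s + (t + c * s - s) mod c"
  have "s \<le> t + c * s" using assms by (simp add: trans_le_add2)
  then have "r mod c = t mod c"
    by (simp add: r_def mod_add_right_eq)
  moreover have "s \<le> r" "r < s + c" using assms by (auto simp: r_def)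
  ultimately show ?thesis by blast
qed

text \<open>The turn of \<open>B\<close> passes through every residue class. There the common result
  lies on the path of \<open>B\<close>, and the path of \<open>B'\<close> is nowhere above the
  result. Used in both directions, this identifies the two paths.\<close>

lemma insert_turn_path_le:
  assumes fc: "first_contact w B m s" and B: "sum_list B = 0" "length B = c"
    and fc': "first_contact w' B' m' s'" and B': "sum_list B' = 0" "length B' = c"
    and c: "c > 0" and eq: "insert_turn w B = insert_turn w' B'"
  shows "m' + periodic_height B' t \<le> m + periodic_height B t"
proof -
  have ne: "B \<noteq> []" "B' \<noteq> []" using B B' c by auto
  obtain r where r: "s \<le> r" "r < s + c" "r mod c = t mod c"
    using exists_congruent_between[OF c] by blast
  have s: "s \<le> length w" using fc by (auto simp: first_contact_def)
  have "m' + periodic_height B' r \<le> height (insert_turn w' B') r"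
    using r s B(2) eq[symmetric]
    by (intro insert_turn_above[OF fc' B'(1) ne(2)]) (simp add: length_insert_turn)
  also have "\<dots> = m + periodic_height B r"
    using height_insert_turn(2)[OF fc B(1) ne(1), of r] r B(2) eq by simp
  finally show ?thesis
    using periodic_height_cong[of r B t] periodic_height_cong[of r B' t] r(3) B(2) B'(2) by simp
qed

text \<open>The result is strictly above the path before \<open>s\<close> but on it at
  \<open>s'\<close>.\<close>

lemma contact_time_insert_turn_le:
  assumes fc: "first_contact w B m s" and fc': "first_contact w' B m s'"
    and B: "sum_list B = 0" "B \<noteq> []" and eq: "insert_turn w B = insert_turn w' B"
  shows "s \<le> s'"
proof (rule ccontr)
  assume "\<not> s \<le> s'"
  then have "m + periodic_height B s' < height (insert_turn w B) s'"
    using fc height_insert_turn(1)[OF fc B, of s'] by (simp add: first_contact_def)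
  then show False
    using height_insert_turn(2)[OF fc' B, of s'] eq by simp
qed

text \<open>The result determines its lower envelope, hence \<open>m\<close> and \<open>B\<close>;
  then the first time on the envelope, hence \<open>s\<close>; and cutting out the turn there leaves
  \<open>w\<close>.\<close>

lemma inj_on_insert_turn:
  assumes pos: "a > 0" "b > 0"
  shows "inj_on (\<lambda>(w, B). insert_turn w B) (UNIV \<times> zero_words a b (a + b))"
proof (rule inj_onI, clarify)
  fix w B w' B'
  assume B: "B \<in> zero_words a b (a + b)" and B': "B' \<in> zero_words a b (a + b)"
    and eq: "insert_turn w B = insert_turn w' B'"
  note BB = zero_wordsD[OF B] and BB' = zero_wordsD[OF B']
  have c: "a + b > 0" using pos by simp
  have ne: "B \<noteq> []" using BB(2) c by auto
  obtain m s where fc: "first_contact w B m s" using first_contact_exists by blast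
  obtain m' s' where fc': "first_contact w' B' m' s'" using first_contact_exists by blast
  have path: "m + periodic_height B t = m' + periodic_height B' t" for t
    using insert_turn_path_le[OF fc BB(3,2) fc' BB'(3,2) c eq, of t]
      insert_turn_path_le[OF fc' BB'(3,2) fc BB(3,2) c eq[symmetric], of t] by simp
  \<comment> \<open>Both periodic paths have height 0 at time 0, so the shifts can be compared
    there.\<close>
  have m: "m = m'" using path[of 0] by (simp add: periodic_height_def)
  have "B = B'"
  proof (rule nth_equalityI)
    show "length B = length B'" using BB(2) BB'(2) by simp
    fix i assume i: "i < length B"
    have ne': "B' \<noteq> []" using BB'(2) c by auto
    have "B ! i = periodic_height B (Suc i) - periodic_height B i"
      using periodic_height_Suc[OF BB(3) ne, of i] i by simp
    also have "\<dots> = periodic_height B' (Suc i) - periodic_height B' i"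
      using path[of i] path[of "Suc i"] m by simp
    also have "\<dots> = B' ! i"
      using periodic_height_Suc[OF BB'(3) ne', of i] i BB(2) BB'(2) by simp
    finally show "B ! i = B' ! i" .
  qed
  note fc' = fc'[folded m this] and eq = eq[folded this]
  have s: "s = s'"
    using contact_time_insert_turn_le[OF fc fc' BB(3) ne eq]
      contact_time_insert_turn_le[OF fc' fc BB(3) ne eq[symmetric]] by simp
  have "length w = length w'"
    using arg_cong[OF eq, of length] by (simp add: length_insert_turn)
  moreover have "take s w @ rotate s B @ drop s w = take s w' @ rotate s B @ drop s w'"
    using eq contact_time_eq[OF fc] contact_time_eq[OF fc'] s by (simp add: insert_turn_def)
  ultimately have "take s w = take s w'" "drop s w = drop s w'"
    by (auto simp: append_eq_append_conv)
  then have "w = w'" by (metis append_take_drop_id)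
  with \<open>B = B'\<close> show "w = w' \<and> B = B'" by simp
qed

section \<open>Removing the lower envelope\<close>

text \<open>Both letters are congruent to \<open>a\<close> modulo \<open>a + b\<close>, so every
  step adds \<open>a\<close> modulo \<open>a + b\<close>.\<close>

lemma height_congruent:
  assumes "set w \<subseteq> {int a, - int b}" "t \<le> length w"
  shows "int (a + b) dvd (height w t - int a * int t)"
  using assms(2)
proof (induction t)
  case 0
  then show ?case by simp
next
  case (Suc t)
  then have "w ! t \<in> {int a, - int b}" using assms(1) by (meson Suc_le_lessD nth_mem subsetD)
  then have "int (a + b) dvd (w ! t - int a)"
  proof (rule insertE)
    assume "w ! t \<in> {- int b}"
    then have "w ! t - int a = int (a + b) * (- 1)" by simp
    then show ?thesis by (metis dvd_triv_left)
  qed simp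
  moreover have "height w (Suc t) - int a * int (Suc t)
      = (height w t - int a * int t) + (w ! t - int a)"
    using Suc.prems by (simp add: height_Suc algebra_simps)
  ultimately show ?case using Suc by (metis Suc_leD dvd_add)
qed

lemma height_gap:
  assumes w: "set w \<subseteq> {int a, - int b}" and t: "s \<le> length w" "t \<le> length w"
    and st: "s mod (a + b) = t mod (a + b)" and less: "height w s < height w t"
  shows "height w s + int (a + b) \<le> height w t"
proof -
  have "int (a + b) dvd (int t - int s)"
    using st by (metis mod_eq_dvd_iff of_nat_mod)
  then have "int (a + b) dvd int a * (int t - int s)" by simp
  then have "int (a + b) dvd (height w t - int a * int t) - (height w s - int a * int s)
      + int a * (int t - int s)"
    using height_congruent[OF w t(1)] height_congruent[OF w t(2)] by (metis dvd_add dvd_diff)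
  then have "int (a + b) dvd (height w t - height w s)" by (simp add: algebra_simps)
  then show ?thesis using less zdvd_imp_le[of "int (a + b)" "height w t - height w s"] by simp
qed

text \<open>\<open>L\<close> is the lower envelope by residue class and \<open>s\<close> the first
  time on it. The core is \<open>follow\<close>: from \<open>s\<close> on, the walk keeps to
  \<open>L\<close> for a full turn, and this block is cut out.\<close>

lemma insert_turn_surj:
  assumes pos: "a > 0" "b > 0" and v: "v \<in> legal_words a b ((a + b) * Suc n)"
  shows "\<exists>w \<in> legal_words a b ((a + b) * n). \<exists>B \<in> zero_words a b (a + b). v = insert_turn w B"
proof -
  define c where "c = a + b"
  define N where "N = c * Suc n"
  have c: "c > 0" "int c = int a + int b" using pos by (auto simp: c_def)
  have lv: "legal a b v" and lenv: "length v = N" and setv: "set v \<subseteq> {int a, - int b}"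
    and sumv: "sum_list v = 0"
    using v zero_wordsD[of v a b] by (auto simp: legal_words_def N_def c_def)
  have Nc: "N mod c = 0" "c \<le> N" by (auto simp: N_def)
  have hN: "height v N = 0" using sumv lenv by (metis height_length)
  \<comment> \<open>Time \<open>N\<close> is included along with time 0; both have residue 0 and
    height 0.\<close>
  define S where "S t = {s. s \<le> N \<and> s mod c = t mod c}" for t
  define L where "L t = Min (height v ` S t)" for t
  have finS: "finite (S t)" for t by (simp add: S_def)
  have neS: "S t \<noteq> {}" for t
    using Nc c by (auto simp: S_def intro!: exI[of _ "t mod c"] order_trans[OF less_imp_le, of _ c N])
  have Lle: "L t \<le> height v s" if "s \<le> N" "s mod c = t mod c" for s t
    using that finS by (auto simp: L_def S_def intro!: Min_le)
  have Lex: "\<exists>s\<le>N. s mod c = t mod c \<and> height v s = L t" for t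
  proof -
    have "L t \<in> height v ` S t" unfolding L_def using finS neS by (intro Min_in) auto
    then show ?thesis by (auto simp: S_def)
  qed
  have Lcong: "L s = L t" if "s mod c = t mod c" for s t
    using that by (simp add: L_def S_def)
  define s where "s = (LEAST t. t \<le> N \<and> height v t = L t)"
  have "\<exists>t. t \<le> N \<and> height v t = L t" using Lex[of 0] Lcong by metis
  then have s: "s \<le> N" "height v s = L s" unfolding s_def by (metis (mono_tags, lifting) LeastI)+
  have least: "height v t \<noteq> L t" if "t < s" for t
    using that s(1) not_less_Least[of t "\<lambda>t. t \<le> N \<and> height v t = L t"] unfolding s_def by simp
  have letter: "v ! t = int a \<or> v ! t = - int b" if "t < N" for t
    using setv that lenv by (metis insertE nth_mem singletonD subsetD)
  have hS: "height v (Suc t) = height v t + v ! t" if "t < N" for t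
    using that lenv by (simp add: height_Suc)
  have follow: "height v (s + i) = L (s + i)" if "i \<le> c" "s + i \<le> N" for i
    using that
  proof (induction i)
    case 0
    then show ?case using s by simp
  next
    case (Suc i)
    define t where "t = s + i"
    have t: "t < N" "t < s + c" "height v t = L t" using Suc by (auto simp: t_def)
    \<comment> \<open>A time realising the envelope at the next residue. It must have a predecessor,
      so \<open>q = 0\<close> is replaced by \<open>N\<close>.\<close>
    obtain q where q: "q \<le> N" "q mod c = Suc t mod c" "height v q = L (Suc t)" "q > 0"
    proof -
      obtain q where q: "q \<le> N" "q mod c = Suc t mod c" "height v q = L (Suc t)" using Lex by blast
      show thesis
      proof (cases "q = 0")
        case True
        then show thesis using that[of N] q hN Nc c by simp
      next
        case False
        then show thesis using that q by simp
      qed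
    qed
    define p where "p = q - 1"
    have p: "q = Suc p" "p < N" using q by (auto simp: p_def)
    have pt: "p mod c = t mod c"
      using q(2) c(1) unfolding p(1) by (metis Suc_inject mod_Suc nat.distinct(1))
    have hq: "L (Suc t) = height v p + v ! p" using q(3) p hS by simp
    have pge: "height v t \<le> height v p" using Lle[of p t] p pt t by simp
    \<comment> \<open>The step out of \<open>p\<close> lands on the envelope, and \<open>p\<close>
      is no lower than \<open>t\<close>. If the step out of \<open>t\<close> is down, it cannot end
      higher than the one out of \<open>p\<close>; only an up-step needs care.\<close>
    have "height v (Suc t) \<le> L (Suc t)"
    proof (cases "v ! t = int a")
      case False
      then show ?thesis using letter[OF t(1)] letter[OF p(2)] hq pge hS[OF t(1)] by auto
    next
      case True
      show ?thesis
      proof (cases "height v p = height v t")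
        case eq: True
        \<comment> \<open>the first exit from this vertex goes up, hence so do all its exits\<close>
        have "v ! p \<noteq> - int b"
        proof (cases p t rule: linorder_cases)
          case less
          \<comment> \<open>Two distinct congruent times cannot both lie in the window of length
            \<open>c\<close> starting at \<open>s\<close>. But before \<open>s\<close> the walk has
            not met the envelope.\<close>
          have "p < s"
          proof (rule ccontr)
            assume "\<not> p < s"
            have "c dvd t - p" using pt less by (metis less_imp_le_nat mod_eq_dvd_iff_nat)
            then have "c \<le> t - p" using less by (simp add: dvd_imp_le)
            then show False using \<open>\<not> p < s\<close> t(2) less by linarith
          qed
          then show ?thesis using least[of p] eq t(3) Lcong[OF pt] by simp
        next
          case equal
          then show ?thesis using True pos by simp
        next
          case greater
          then show ?thesis
            using lv[unfolded legal_def] eq True pt p(2) lenv unfolding c_def by metis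
        qed
        then show ?thesis using letter[OF p(2)] hq hS[OF t(1)] eq True by simp
      next
        case False
        \<comment> \<open>By congruence \<open>p\<close> is at least \<open>a + b\<close> higher, so
          even a down-step from \<open>p\<close> ends no lower than the up-step from
          \<open>t\<close>.\<close>
        then have "height v t + int (a + b) \<le> height v p"
          using height_gap[OF setv, of t p] t(1) p(2) lenv pt pge by (simp add: c_def)
        then show ?thesis using letter[OF p(2)] hq hS[OF t(1)] True by auto
      qed
    qed
    moreover have "L (Suc t) \<le> height v (Suc t)" using Lle t(1) by simp
    ultimately show ?case by (simp add: t_def)
  qed
  \<comment> \<open>Otherwise the walk stays on the envelope up to time \<open>N\<close>. Then time
    0 is on it as well, so \<open>s = 0\<close>, and the turn fits because
    \<open>c \<le> N\<close>.\<close>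
  have sc: "s + c \<le> N"
  proof (rule ccontr)
    assume "\<not> s + c \<le> N"
    then have "height v N = L N" using follow[of "N - s"] s(1) by simp
    then have "height v 0 = L 0" using hN Lcong[of N 0] Nc by simp
    then have "s = 0" using least[of 0] by blast
    then show False using \<open>\<not> s + c \<le> N\<close> Nc by simp
  qed
  \<comment> \<open>The increments of the envelope over one period, starting at phase 0. They sum to
    zero because \<open>L\<close> is periodic, and \<open>L 0\<close> becomes the shift.\<close>
  define B where "B = map (\<lambda>i. L (Suc i) - L i) [0..<c]"
  define w where "w = take s v @ drop (s + c) v"
  have lenB: "length B = c" by (simp add: B_def)
  have Bne: "B \<noteq> []" using lenB c by auto
  have rot: "rotate s B = take c (drop s v)"
  proof (rule nth_equalityI)
    show "length (rotate s B) = length (take c (drop s v))" using lenB sc lenv by simp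
    fix i assume "i < length (rotate s B)"
    then have i: "i < c" using lenB by simp
    have "rotate s B ! i = L (Suc ((s + i) mod c)) - L ((s + i) mod c)"
      using i lenB c by (simp add: nth_rotate B_def)
    also have "\<dots> = L (Suc (s + i)) - L (s + i)"
      using Lcong[of "Suc ((s + i) mod c)" "Suc (s + i)"] Lcong[of "(s + i) mod c" "s + i"]
      by (simp add: mod_Suc_eq)
    also have "\<dots> = v ! (s + i)"
      using follow[of i] follow[of "Suc i"] hS[of "s + i"] i sc by simp
    finally show "rotate s B ! i = take c (drop s v) ! i" using i sc lenv by simp
  qed
  have hB: "height B i = L i - L 0" if "i \<le> c" for i
    using that by (induction i) (auto simp: height_Suc lenB, auto simp: B_def)
  have sumB: "sum_list B = 0" using hB[of c] lenB Lcong[of c 0] height_length[of B] by simp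
  have setB: "set B \<subseteq> {int a, - int b}"
  proof -
    have "set B = set (take c (drop s v))" using rot by (metis set_rotate)
    then show ?thesis using setv by (auto dest: in_set_takeD in_set_dropD)
  qed
  have perB: "L 0 + periodic_height B t = L t" for t
    using hB[of "t mod c"] c Lcong[of "t mod c" t] by (simp add: periodic_height_def lenB)
  have veq: "v = take s v @ take c (drop s v) @ drop (s + c) v"
    by (metis add.commute append_take_drop_id drop_drop)
  have lenw: "length w = N - c" using sc lenv by (simp add: w_def)
  have hw1: "height w t = height v t" if "t \<le> s" for t
    using that s lenv by (simp add: w_def height_append1 height_def min_def)
  have sum0: "sum_list (take c (drop s v)) = 0" using sumB rot by (metis sum_list_rotate)
  have hw2: "height w t = height v (t + c)" if "s \<le> t" for t
  proof -
    have "height w t = height v s + height (drop (s + c) v) (t - s)"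
      using height_append2[of "take s v" "drop (s + c) v" "t - s"] that s lenv
      by (simp add: w_def height_def)
    moreover have "height v (s + (c + (t - s))) = height v s + height (drop (s + c) v) (t - s)"
      using sum0 by (simp add: height_def take_add add.commute)
    moreover have "s + (c + (t - s)) = t + c" using that by simp
    ultimately show ?thesis by metis
  qed
  have nw1: "w ! t = v ! t" if "t < s" for t
    using that s lenv by (simp add: w_def nth_append)
  have nw2: "w ! t = v ! (t + c)" if "s \<le> t" "t < N - c" for t
    using that sc lenv by (simp add: w_def nth_append add.commute)
  \<comment> \<open>Every height of \<open>w\<close> is a height of \<open>v\<close> at a congruent
    time, so \<open>L\<close> still bounds it from below; up to time \<open>s\<close> nothing has
    changed.\<close>
  have fc: "first_contact w B (L 0) s"
    unfolding first_contact_def perB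
  proof (intro conjI allI impI)
    show "s \<le> length w" using sc lenw by simp
    show "height w s = L s" using hw1 s by simp
    fix t
    show "L t \<le> height w t" if "t \<le> length w"
    proof (cases "t \<le> s")
      case True
      then show ?thesis using hw1 Lle s by simp
    next
      case False
      then show ?thesis using hw2[of t] Lle[of "t + c" t] that lenw sc by simp
    qed
    show "L t < height w t" if "t < s"
      using that hw1[of t] Lle[of t t] least[of t] s by simp
  qed
  have "v = insert_turn w B"
  proof -
    have "take s w = take s v" "drop s w = drop (s + c) v"
      using s lenv by (auto simp: w_def)
    then show ?thesis
      using contact_time_eq[OF fc] rot veq by (simp add: insert_turn_def)
  qed
  moreover have "B \<in> zero_words a b (a + b)"
    using setB sumB lenB by (simp add: zero_words_def words_def zero_sum_def c_def)
  moreover have "w \<in> legal_words a b ((a + b) * n)"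
  proof -
    have "set w \<subseteq> {int a, - int b}"
      using setv by (auto simp: w_def dest: in_set_takeD in_set_dropD)
    moreover have "sum_list w = 0"
      using hw2[of "length w"] lenw sc hN by (simp add: height_length[symmetric])
    moreover have "length w = (a + b) * n" using lenw by (simp add: N_def c_def)
    moreover have "legal a b w"
      unfolding legal_def
    proof (intro allI impI notI)
      fix i k
      assume ik: "i < k" "k < length w" "i mod (a + b) = k mod (a + b)"
        "height w i = height w k" "w ! i = int a" "w ! k = - int b"
      \<comment> \<open>Reinserting the turn moves positions from \<open>s\<close> on by
        \<open>c\<close>, preserving order, residues, heights and letters, so a violation in
        \<open>w\<close> would be one in \<open>v\<close>.\<close>
      have new: False if "i' < k'" "k' < N" "i' mod c = k' mod c"
        "height v i' = height v k'" "v ! i' = int a" "v ! k' = - int b" for i' k'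
        using lv that lenv unfolding legal_def c_def by blast
      have mod: "i mod c = k mod c" using ik(3) by (simp add: c_def)
      have kN: "k < N - c" "k + c < N" using ik(2) lenw by linarith+
      consider "k < s" | "i < s" "s \<le> k" | "s \<le> i" using ik(1) by linarith
      then show False
      proof cases
        case 1
        then show ?thesis
          using new[of i k] ik mod s hw1[of i] hw1[of k] nw1[of i] nw1[of k] by simp
      next
        case 2
        then show ?thesis
          using new[of i "k + c"] ik mod kN hw1[of i] hw2[of k] nw1[of i] nw2[of k] by simp
      next
        case 3
        then show ?thesis
          using new[of "i + c" "k + c"] ik mod kN hw2[of i] hw2[of k] nw2[of i] nw2[of k] by simp
      qed
    qed
    ultimately show ?thesis
      by (simp add: legal_words_def zero_words_def words_def zero_sum_def)
  qed
  ultimately show ?thesis by blast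
qed

lemma card_legal_words_Suc:
  assumes "a > 0" "b > 0"
  shows "card (legal_words a b ((a + b) * Suc n))
       = card (legal_words a b ((a + b) * n)) * card (zero_words a b (a + b))"
proof -
  let ?D = "legal_words a b ((a + b) * n) \<times> zero_words a b (a + b)"
  have "(\<lambda>(w, B). insert_turn w B) ` ?D = legal_words a b ((a + b) * Suc n)"
    using legal_insert_turn[OF assms] insert_turn_surj[OF assms] by fast
  moreover have "inj_on (\<lambda>(w, B). insert_turn w B) ?D"
    using inj_on_insert_turn[OF assms] by (rule inj_on_subset) auto
  ultimately show ?thesis
    by (metis card_cartesian_product card_image)
qed

section \<open>Counting zero-sum words of length \<open>a + b\<close>\<close>

text \<open>Splitting by the first letter gives Pascal's rule.\<close>

lemma card_lists_count:
  assumes "x \<noteq> y"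
  shows "card {w. set w \<subseteq> {x, y} \<and> length w = m \<and> count_list w x = k} = m choose k"
proof (induction m arbitrary: k)
  case 0
  have "{w. set w \<subseteq> {x, y} \<and> length w = 0 \<and> count_list w x = k} = (if k = 0 then {[]} else {})"
    by auto
  then show ?case by (cases k) auto
next
  case (Suc m)
  let ?A = "\<lambda>m k. {w. set w \<subseteq> {x, y} \<and> length w = m \<and> count_list w x = k}"
  have fin: "finite (?A m k)" for m k
    by (rule finite_subset[OF _ finite_lists_length_eq[of "{x, y}" m]]) auto
  show ?case
  proof (cases k)
    case 0
    have "?A (Suc m) k = Cons y ` ?A m 0"
      using assms 0 by (auto simp: length_Suc_conv split: if_splits)
    then show ?thesis using Suc[of 0] 0 by (simp add: card_image)
  next
    case (Suc l)
    have "?A (Suc m) k = Cons x ` ?A m l \<union> Cons y ` ?A m k"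
      using assms Suc by (auto simp: length_Suc_conv split: if_splits)
    moreover have "Cons x ` ?A m l \<inter> Cons y ` ?A m k = {}" using assms by auto
    ultimately have "card (?A (Suc m) k) = card (?A m l) + card (?A m k)"
      using fin by (simp add: card_Un_disjoint card_image)
    then show ?thesis using Suc.IH Suc by simp
  qed
qed

lemma sum_list_count:
  fixes x y :: int
  assumes "set w \<subseteq> {x, y}"
  shows "sum_list w = x * int (count_list w x) + y * (int (length w) - int (count_list w x))"
  using assms by (induction w) (auto simp: algebra_simps)

text \<open>A word of length \<open>a + b\<close> with \<open>k\<close> letters \<open>int a\<close>
  has sum \<open>(a + b) * (k - b)\<close>, so zero-sum means exactly \<open>b\<close>
  up-steps.\<close>

lemma card_zero_words:
  assumes "a > 0" "b > 0"
  shows "card (zero_words a b (a + b)) = (a + b) choose a"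
proof -
  have "zero_words a b (a + b)
      = {w. set w \<subseteq> {int a, - int b} \<and> length w = a + b \<and> count_list w (int a) = b}"
  proof -
    have "sum_list w = 0 \<longleftrightarrow> count_list w (int a) = b"
      if "set w \<subseteq> {int a, - int b}" "length w = a + b" for w
    proof -
      have "sum_list w = (int a + int b) * (int (count_list w (int a)) - int b)"
        using sum_list_count[OF that(1)] that(2) by (simp add: algebra_simps)
      then show ?thesis using assms by auto
    qed
    then show ?thesis by (auto simp: zero_words_def words_def zero_sum_def)
  qed
  also have "card \<dots> = (a + b) choose b"
    using assms by (intro card_lists_count) simp
  also have "\<dots> = (a + b) choose a"
    using binomial_symmetric[of b "a + b"] by simp
  finally show ?thesis .
qed

theorem theorem3:
  fixes a b n :: nat
  assumes "a > 0" and "b > 0"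
  shows "card {w \<in> words a b ((a + b) * n). zero_sum w \<and>
           \<not> (\<exists>i j. illegal a b w i j \<and> (a + b) dvd length (subword w i j))}
         = ((a + b) choose a) ^ n"
proof -
  have "card (legal_words a b ((a + b) * n)) = ((a + b) choose a) ^ n"
  proof (induction n)
    case 0
    have "legal_words a b ((a + b) * 0) = {[]}"
      by (auto simp: legal_words_def zero_words_def words_def zero_sum_def legal_def)
    then show ?case by simp
  next
    case (Suc n)
    then show ?case
      using card_legal_words_Suc[OF assms, of n] card_zero_words[OF assms] by (simp add: mult.commute)
  qed
  moreover have "legal_words a b ((a + b) * n) = {w \<in> words a b ((a + b) * n). zero_sum w \<and>
           \<not> (\<exists>i j. illegal a b w i j \<and> (a + b) dvd length (subword w i j))}"
    unfolding legal_words_def zero_words_def legal_iff by blast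
  ultimately show ?thesis by simp
qed

end
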